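(* Let $G$ be a graph with $G\in\mathfrak{N}$ and let $n\geq 1$ be an integer. Then $G[nK_1]\in\mathfrak{N}$. Moreover, $w(G[nK_1])\leq w(G)\cdot n$ and $W(G[nK_1])\geq (W(G)+1)\cdot n-1$.
   Context: All graphs are finite, undirected, without loops or multiple edges. An edge coloring of a graph $G$ with colors $1,2,\ldots,t$ is an interval $t$-coloring if every color $i\in\{1,\ldots,t\}$ is used on at least one edge, and for every vertex $v$ the colors of the edges incident to $v$ are pairwise distinct and form an interval of consecutive integers. $G$ is interval colorable if it has an interval $t$-coloring for some integer $t\geq 1$; $\mathfrak{N}$ denotes the set of interval colorable graphs. For $G\in\mathfrak{N}$, $w(G)$ and $W(G)$ denote the least and greatest $t$ for which $G$ has an interval $t$-coloring. $nK_1$ is the edgeless graph on $n$ vertices. The lexicographic product $G[H]$ has vertex set $V(G)\times V(H)$, with $(u_1,v_1)$ adjacent to $(u_2,v_2)$ iff either $u_1u_2\in E(G)$, or ($u_1=u_2$ and $v_1v_2\in E(H)$). *)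

theory Defs
  imports Main
begin

datatype 'a graph = Graph (verts: "'a set") (edges: "'a set set")

text \<open>Edges are two-element sets of vertices, so there are no loops and no multiple edges.\<close>

definition simple_graph :: "'a graph \<Rightarrow> bool" where
  "simple_graph G \<longleftrightarrow> finite (verts G) \<and> (\<forall>e\<in>edges G. e \<subseteq> verts G \<and> card e = 2)"

definition incident_edges :: "'a graph \<Rightarrow> 'a \<Rightarrow> 'a set set" where
  "incident_edges G v = {e \<in> edges G. v \<in> e}"

text \<open>
  Only the values of the colouring on the edges matter. The equation for the image of the edge set
  says both that the colours lie between 1 and t and that each of them is used. An isolated vertex
  imposes no condition, since the interval from a to b is empty when b is less than a.
\<close>

definition interval_coloring :: "'a graph \<Rightarrow> nat \<Rightarrow> ('a set \<Rightarrow> nat) \<Rightarrow> bool" where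
  "interval_coloring G t c \<longleftrightarrow>
     c ` edges G = {1..t} \<and>
     (\<forall>v\<in>verts G. inj_on c (incident_edges G v) \<and> (\<exists>a b. c ` incident_edges G v = {a..b}))"

definition has_interval_coloring :: "'a graph \<Rightarrow> nat \<Rightarrow> bool" where
  "has_interval_coloring G t \<longleftrightarrow> t \<ge> 1 \<and> (\<exists>c. interval_coloring G t c)"

definition interval_colorable_graphs :: "'a graph set" ("\<NN>") where
  "\<NN> = {G. simple_graph G \<and> (\<exists>t. has_interval_coloring G t)}"

text \<open>
  The set of admissible t is finite, because t is at most the number of edges; it is nonempty
  for interval colourable graphs. So the minimum and maximum below are the intended ones.
\<close>

definition min_colors :: "'a graph \<Rightarrow> nat" where
  "min_colors G = Min {t. has_interval_coloring G t}"

definition max_colors :: "'a graph \<Rightarrow> nat" where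
  "max_colors G = Max {t. has_interval_coloring G t}"

definition edgeless_graph :: "nat \<Rightarrow> nat graph" where
  "edgeless_graph n = Graph {..<n} {}"

definition lex_product :: "'a graph \<Rightarrow> 'b graph \<Rightarrow> ('a \<times> 'b) graph" where
  "lex_product G H = Graph (verts G \<times> verts H)
     {{(u1, v1), (u2, v2)} | u1 v1 u2 v2.
        u1 \<in> verts G \<and> v1 \<in> verts H \<and> u2 \<in> verts G \<and> v2 \<in> verts H \<and>
        ({u1, u2} \<in> edges G \<or> (u1 = u2 \<and> {v1, v2} \<in> edges H))}"

end

theory Submission
  imports Defs
begin

text \<open>
  Every edge \<open>uv\<close> of \<open>G\<close> becomes a copy of the complete bipartite graph \<open>K\<^sub>n\<^sub>,\<^sub>n\<close> in the
  product. Given an interval colouring \<open>c\<close> of \<open>G\<close> with colours counted from 0, colour the edge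
  joining \<open>(u, i)\<close> and \<open>(v, j)\<close> by \<open>c(uv) n + \<phi>(i + j)\<close>. If for each fixed \<open>i\<close> the numbers
  \<open>\<phi>(i + j)\<close> run through \<open>n\<close> consecutive integers, then the copies of \<open>uv\<close> at \<open>(u, i)\<close> fill a block
  of length \<open>n\<close>, and blocks for consecutive values of \<open>c\<close> are adjacent. Taking \<open>\<phi>(k) = k mod n\<close>
  uses \<open>t n\<close> colours, and \<open>\<phi>(k) = k\<close> uses \<open>(t - 1) n + (2 n - 1)\<close> colours.
\<close>

text \<open>Counting from 0 with half-open intervals lets colour \<open>a\<close> expand to a block
  of length \<open>n\<close> starting at a multiple of \<open>n\<close>, up to a shift common to the
  vertex. The arguments below then become division with remainder by \<open>n\<close>.\<close>

lemma has_interval_coloring_iff_zero_based: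
  "has_interval_coloring G t \<longleftrightarrow> t \<ge> 1 \<and> (\<exists>c. c ` edges G = {..<t} \<and>
     (\<forall>v\<in>verts G. inj_on c (incident_edges G v) \<and> (\<exists>a b. c ` incident_edges G v = {a..<b})))"
  (is "_ \<longleftrightarrow> t \<ge> 1 \<and> (\<exists>c. ?Z c)")
proof
  assume "has_interval_coloring G t"
  then obtain c where t: "t \<ge> 1" and c: "interval_coloring G t c"
    by (auto simp: has_interval_coloring_def)
  have im: "c ` edges G = {1..t}" using c by (simp add: interval_coloring_def)
  define d where "d = (\<lambda>e. c e - 1)"
  have d: "d ` A = (\<lambda>x. x - 1) ` c ` A" for A
    by (auto simp: d_def image_image)
  have shift: "(\<lambda>x::nat. x - 1) ` {a..b} = {a - 1..<b}" if "a \<ge> 1" for a b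
  proof -
    have "{a..b} = Suc ` {a - 1..<b}"
      using that by (simp add: atLeastLessThanSuc_atLeastAtMost)
    then show ?thesis by (simp only: image_image) simp
  qed
  have "?Z d"
  proof (intro conjI ballI)
    show "d ` edges G = {..<t}" unfolding d im by (subst shift) auto
  next
    fix v assume v: "v \<in> verts G"
    have pos: "c e \<ge> 1" if "e \<in> incident_edges G v" for e
      using that im by (auto simp: incident_edges_def)
    show "inj_on d (incident_edges G v)"
      using c v pos unfolding interval_coloring_def inj_on_def d_def
      by (metis le_add_diff_inverse)
    obtain a b where ab: "c ` incident_edges G v = {a..b}"
      using c v unfolding interval_coloring_def by blast
    show "\<exists>a b. d ` incident_edges G v = {a..<b}"
    \<comment> \<open>If \<open>a \<le> b\<close>, then \<open>a\<close> is itself a colour at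
      \<open>v\<close>, hence positive, and subtracting 1 is not truncated. Otherwise the interval
      is empty, as at an isolated vertex.\<close>
    proof (cases "a \<le> b")
      case True
      then have "a \<in> c ` incident_edges G v" using ab by simp
      then have "a \<ge> 1" using pos by auto
      then show ?thesis unfolding d ab by (subst shift) auto
    next
      case False
      then show ?thesis unfolding d ab by auto
    qed
  qed
  with t show "t \<ge> 1 \<and> (\<exists>c. ?Z c)" by blast
next
  assume "t \<ge> 1 \<and> (\<exists>c. ?Z c)"
  then obtain c where t: "t \<ge> 1" and c: "?Z c" by blast
  define d where "d = (\<lambda>e. Suc (c e))"
  have d: "d ` A = Suc ` c ` A" for A
    by (auto simp: d_def image_image)
  have "interval_coloring G t d"
    unfolding interval_coloring_def
  proof (intro conjI ballI)
    show "d ` edges G = {1..t}"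
      unfolding d using c by (simp add: lessThan_atLeast0 atLeastLessThanSuc_atLeastAtMost)
  next
    fix v assume v: "v \<in> verts G"
    then show "inj_on d (incident_edges G v)"
      using c by (auto simp: inj_on_def d_def)
    obtain a b where "c ` incident_edges G v = {a..<b}" using c v by blast
    then show "\<exists>a b. d ` incident_edges G v = {a..b}"
      unfolding d by (metis image_Suc_atLeastLessThan atLeastLessThanSuc_atLeastAtMost)
  qed
  with t show "has_interval_coloring G t" by (auto simp: has_interval_coloring_def)
qed

lemma finite_has_interval_coloring:
  assumes "simple_graph G"
  shows "finite {t. has_interval_coloring G t}"
proof (rule finite_subset)
  have fin: "finite (edges G)"
    by (rule finite_subset[of _ "Pow (verts G)"]) (use assms in \<open>auto simp: simple_graph_def\<close>)
  show "{t. has_interval_coloring G t} \<subseteq> {..card (edges G)}"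
  proof safe
    fix t assume "has_interval_coloring G t"
    then obtain c where "c ` edges G = {1..t}"
      by (auto simp: has_interval_coloring_def interval_coloring_def)
    then show "t \<le> card (edges G)" using card_image_le[OF fin, of c] by simp
  qed
qed simp

lemma verts_lex_product_edgeless: "verts (lex_product G (edgeless_graph n)) = verts G \<times> {..<n}"
  by (simp add: lex_product_def edgeless_graph_def)

lemma edges_lex_product_edgeless:
  assumes "simple_graph G"
  shows "edges (lex_product G (edgeless_graph n)) =
           {{(u, i), (v, j)} | u i v j. {u, v} \<in> edges G \<and> i < n \<and> j < n}"
proof -
  have "u \<in> verts G \<and> v \<in> verts G" if "{u, v} \<in> edges G" for u v
    using assms that by (auto simp: simple_graph_def)
  then show ?thesis
    unfolding lex_product_def edgeless_graph_def graph.sel by blast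
qed

lemma incident_edges_lex_product_edgeless:
  assumes "simple_graph G" and "i < n"
  shows "incident_edges (lex_product G (edgeless_graph n)) (u, i) =
           {{(u, i), (v, j)} | v j. {u, v} \<in> edges G \<and> j < n}"
proof -
  \<comment> \<open>An edge through \<open>(u, i)\<close> may list that vertex second; these swaps
    bring it to the front.\<close>
  have "{(v, j), (u, i)} = {(u, i), (v, j)}" "{v, u} = {u, v}" for v j by auto
  then show ?thesis
    unfolding incident_edges_def edges_lex_product_edgeless[OF assms(1)] using assms(2)
    by (auto; metis)
qed

lemma simple_graph_edge_neq: "simple_graph G \<Longrightarrow> {u, v} \<in> edges G \<Longrightarrow> u \<noteq> v"
  by (force simp: simple_graph_def)

lemma simple_graph_lex_product_edgeless:
  assumes "simple_graph G"
  shows "simple_graph (lex_product G (edgeless_graph n))"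
  unfolding simple_graph_def
proof (intro conjI ballI)
  show "finite (verts (lex_product G (edgeless_graph n)))"
    using assms by (simp add: verts_lex_product_edgeless simple_graph_def)
next
  fix e assume "e \<in> edges (lex_product G (edgeless_graph n))"
  then obtain u i v j where e: "e = {(u, i), (v, j)}" "{u, v} \<in> edges G" "i < n" "j < n"
    unfolding edges_lex_product_edgeless[OF assms] by blast
  show "card e = 2" using e simple_graph_edge_neq[OF assms e(2)] by simp
  have "{u, v} \<subseteq> verts G" using assms e(2) unfolding simple_graph_def by blast
  then show "e \<subseteq> verts (lex_product G (edgeless_graph n))"
    using e by (simp add: verts_lex_product_edgeless)
qed

text \<open>\<open>block\<close> is the condition at one vertex, \<open>range\<close> governs the
  whole colour set. They are separate because the window start \<open>s\<close> may vary with
  \<open>i\<close>, so \<open>m\<close> can exceed \<open>n\<close>. By \<open>n \<le> m\<close>,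
  copies of \<open>{..<m}\<close> shifted by successive multiples of \<open>n\<close> leave no gap;
  the last starts at \<open>(t - 1) * n\<close>.\<close>

lemma has_interval_coloring_lex_product_edgeless:
  fixes \<phi> :: "nat \<Rightarrow> nat"
  assumes G: "simple_graph G" and col: "has_interval_coloring G t" and n: "n \<ge> 1"
    and block: "\<And>i. i < n \<Longrightarrow> \<exists>s. bij_betw (\<lambda>j. \<phi> (i + j)) {..<n} {s..<s + n}"
    and range: "(\<lambda>(i, j). \<phi> (i + j)) ` ({..<n} \<times> {..<n}) = {..<m}" and "n \<le> m"
  shows "has_interval_coloring (lex_product G (edgeless_graph n)) ((t - 1) * n + m)"
proof -
  let ?P = "lex_product G (edgeless_graph n)"
  obtain c where t: "t \<ge> 1" and im: "c ` edges G = {..<t}"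
    and c: "\<And>v. v \<in> verts G \<Longrightarrow> inj_on c (incident_edges G v)"
      "\<And>v. v \<in> verts G \<Longrightarrow> \<exists>a b. c ` incident_edges G v = {a..<b}"
    using col unfolding has_interval_coloring_iff_zero_based by metis
  \<comment> \<open>Summing the second components makes the colour well defined on unordered pairs.\<close>
  define d where "d = (\<lambda>e. c (fst ` e) * n + \<phi> (sum snd e))"
  \<comment> \<open>Since \<open>u\<close> and \<open>v\<close> differ, the two pairs are distinct
    even when \<open>i = j\<close>, so \<open>sum snd\<close> counts both indices.\<close>
  have d: "d {(u, i), (v, j)} = c {u, v} * n + \<phi> (i + j)" if "{u, v} \<in> edges G" for u i v j
    using simple_graph_edge_neq[OF G that] by (simp add: d_def)
  have "d ` edges ?P = {..<(t - 1) * n + m}"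
  proof (intro equalityI subsetI)
    fix x assume "x \<in> d ` edges ?P"
    then obtain u i v j where e: "{u, v} \<in> edges G" "i < n" "j < n"
      and x: "x = c {u, v} * n + \<phi> (i + j)"
      unfolding edges_lex_product_edgeless[OF G] using d by auto
    have "c {u, v} \<in> {..<t}" unfolding im[symmetric] using e(1) by (rule imageI)
    then have "c {u, v} * n \<le> (t - 1) * n" by (intro mult_le_mono1) simp
    moreover have "(\<lambda>(i, j). \<phi> (i + j)) (i, j) \<in> {..<m}"
      unfolding range[symmetric] using e(2,3) by (intro imageI) simp
    then have "\<phi> (i + j) < m" by simp
    ultimately show "x \<in> {..<(t - 1) * n + m}"
      unfolding x by (simp add: add_le_less_mono)
  next
    fix x assume x: "x \<in> {..<(t - 1) * n + m}"
    \<comment> \<open>Below \<open>t * n\<close>, quotient and remainder by \<open>n\<close> serve.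
      Any larger \<open>x\<close> lies in the overhang of the last copy of \<open>{..<m}\<close>, so
      \<open>a = t - 1\<close>.\<close>
    have "\<exists>a r. a < t \<and> r < m \<and> x = a * n + r"
    proof (cases "x < t * n")
      case True
      then have "x div n < t" by (rule less_mult_imp_div_less)
      moreover have "x mod n < m" using n by (intro less_le_trans[OF _ \<open>n \<le> m\<close>]) simp
      ultimately show ?thesis by (metis div_mult_mod_eq)
    next
      case False
      then have "(t - 1) * n \<le> x"
        by (intro le_trans[of "(t - 1) * n" "t * n" x]) simp_all
      then have "t - 1 < t \<and> x - (t - 1) * n < m \<and> x = (t - 1) * n + (x - (t - 1) * n)"
        using x t n \<open>n \<le> m\<close> by auto
      then show ?thesis by blast
    qed
    then obtain a r where ar: "a < t" "r < m" "x = a * n + r" by blast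
    obtain e where e: "e \<in> edges G" "c e = a" using im ar(1) by (metis imageE lessThan_iff)
    have "card e = 2" using G e(1) by (simp add: simple_graph_def)
    then obtain u v where uv: "e = {u, v}" by (auto simp: card_2_iff)
    have "r \<in> (\<lambda>(i, j). \<phi> (i + j)) ` ({..<n} \<times> {..<n})" using range ar(2) by simp
    then obtain i j where ij: "i < n" "j < n" "\<phi> (i + j) = r" by auto
    have "x = d {(u, i), (v, j)}" using d e uv ij ar by simp
    then show "x \<in> d ` edges ?P"
      unfolding edges_lex_product_edgeless[OF G] using e uv ij by blast
  qed
  moreover have "inj_on d (incident_edges ?P w) \<and> (\<exists>a b. d ` incident_edges ?P w = {a..<b})"
    if w_vert: "w \<in> verts ?P" for w
  proof -
    obtain u i where w: "w = (u, i)" and u: "u \<in> verts G" and i: "i < n"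
      using w_vert by (auto simp: verts_lex_product_edgeless)
    obtain s where s: "bij_betw (\<lambda>j. \<phi> (i + j)) {..<n} {s..<s + n}" using block i by blast
    have bounds: "s \<le> \<phi> (i + j)" "\<phi> (i + j) < s + n" if "j < n" for j
      using bij_betwE[OF s] that by auto
    have inc: "incident_edges ?P w = {{(u, i), (v, j)} | v j. {u, v} \<in> edges G \<and> j < n}"
      unfolding w by (rule incident_edges_lex_product_edgeless[OF G i])
    have "inj_on d (incident_edges ?P w)"
    proof (rule inj_onI)
      fix e e' assume "e \<in> incident_edges ?P w" "e' \<in> incident_edges ?P w" and eq: "d e = d e'"
      then obtain v j v' j' where e: "e = {(u, i), (v, j)}" "{u, v} \<in> edges G" "j < n"
        and e': "e' = {(u, i), (v', j')}" "{u, v'} \<in> edges G" "j' < n"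
        unfolding inc by blast
      \<comment> \<open>Subtracting \<open>s\<close> moves the window to \<open>{..<n}\<close>, so
        dividing by \<open>n\<close> recovers the colour of the edge of \<open>G\<close>.\<close>
      have eq2: "c {u, v} * n + (\<phi> (i + j) - s) = c {u, v'} * n + (\<phi> (i + j') - s)"
        using eq e e' d bounds[of j] bounds[of j'] by simp
      have small: "\<phi> (i + j) - s < n" "\<phi> (i + j') - s < n"
        using bounds[of j] bounds[of j'] e e' by auto
      have cc: "c {u, v} = c {u, v'}"
        using arg_cong[OF eq2, of "\<lambda>x. x div n"] small n by simp
      have "{u, v} = {u, v'}"
        using inj_onD[OF c(1)[OF u] cc] e(2) e'(2) by (simp add: incident_edges_def)
      then have "v = v'" by (auto simp: doubleton_eq_iff)
      moreover have "\<phi> (i + j) = \<phi> (i + j')" using eq e e' d cc by simp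
      then have "j = j'"
        using inj_onD[OF bij_betw_imp_inj_on[OF s], of j j'] e(3) e'(3) by simp
      ultimately show "e = e'" using e e' by simp
    qed
    moreover obtain a b where ab: "c ` incident_edges G u = {a..<b}" using c(2)[OF u] by blast
    \<comment> \<open>Colour \<open>q\<close> at \<open>u\<close> contributes the block from
      \<open>q * n + s\<close> up to, but excluding, \<open>(q + 1) * n + s\<close>. As
      \<open>s\<close> depends only on \<open>i\<close>, the blocks for \<open>q\<close> in
      \<open>{a..<b}\<close> tile the interval.\<close>
    have "d ` incident_edges ?P w = {a * n + s..<b * n + s}"
    proof (intro equalityI subsetI)
      fix x assume "x \<in> d ` incident_edges ?P w"
      then obtain v j where v: "{u, v} \<in> edges G" "j < n" and x: "x = c {u, v} * n + \<phi> (i + j)"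
        unfolding inc using d by auto
      have "c {u, v} \<in> {a..<b}"
        unfolding ab[symmetric] using v(1) by (intro imageI) (simp add: incident_edges_def)
      then have "a * n \<le> c {u, v} * n" "Suc (c {u, v}) * n \<le> b * n"
        by (intro mult_le_mono1; simp)+
      then show "x \<in> {a * n + s..<b * n + s}"
        using bounds[OF v(2)] unfolding x atLeastLessThan_iff mult_Suc by linarith
    next
      fix x assume x: "x \<in> {a * n + s..<b * n + s}"
      let ?q = "(x - s) div n" and ?r = "(x - s) mod n"
      have "a * n \<le> x - s" "x - s < b * n"
        using x unfolding atLeastLessThan_iff by linarith+
      then have "a \<le> ?q" "?q < b"
        using n by (simp_all add: less_eq_div_iff_mult_less_eq less_mult_imp_div_less)
      then have "?q \<in> c ` incident_edges G u" unfolding ab by simp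
      then obtain e where e: "e \<in> edges G" "u \<in> e" "c e = ?q"
        by (auto simp: incident_edges_def)
      then have "card e = 2" using G by (simp add: simple_graph_def)
      then obtain v where v: "e = {u, v}" using \<open>u \<in> e\<close> by (auto simp: card_2_iff)
      have "s + ?r \<in> (\<lambda>j. \<phi> (i + j)) ` {..<n}"
        using s n by (simp add: bij_betw_def)
      then obtain j where j: "j < n" "\<phi> (i + j) = s + ?r" by auto
      have "x = ?q * n + (s + ?r)"
        using x div_mult_mod_eq[of "x - s" n] by simp
      then have "x = d {(u, i), (v, j)}" using d e v j by simp
      then show "x \<in> d ` incident_edges ?P w" unfolding inc using e v j by blast
    qed
    ultimately show ?thesis by blast
  qed
  moreover have "(t - 1) * n + m \<ge> 1" using n \<open>n \<le> m\<close> by simp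
  ultimately show ?thesis unfolding has_interval_coloring_iff_zero_based by blast
qed

text \<open>Two arguments with the same value would differ by a positive multiple of
  \<open>n\<close> that is less than \<open>n\<close>. An injective self-map of a finite set is
  onto.\<close>

lemma bij_betw_add_mod:
  fixes i n :: nat
  shows "bij_betw (\<lambda>j. (i + j) mod n) {..<n} {..<n}"
proof (cases "n = 0")
  case False
  have "inj_on (\<lambda>j. (i + j) mod n) {..<n}"
  proof (rule linorder_inj_onI')
    fix j k assume jk: "j \<in> {..<n}" "k \<in> {..<n}" "j < k"
    show "(i + j) mod n \<noteq> (i + k) mod n"
    proof
      assume "(i + j) mod n = (i + k) mod n"
      then have "n dvd (i + k) - (i + j)"
        using jk mod_eq_dvd_iff_nat[of "i + j" "i + k" n] by simp
      then show False using jk by (auto dest: dvd_imp_le)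
    qed
  qed
  then show ?thesis
    using False by (simp add: bij_betw_def) (intro endo_inj_surj; auto)
qed (simp add: bij_betw_def)

text \<open>Reduction modulo \<open>n\<close> gives every \<open>i\<close> the same window
  \<open>{..<n}\<close>, so \<open>s = 0\<close> and \<open>m = n\<close>.\<close>

lemma has_interval_coloring_lex_product_edgeless_mult:
  assumes "simple_graph G" "has_interval_coloring G t" "n \<ge> 1"
  shows "has_interval_coloring (lex_product G (edgeless_graph n)) (t * n)"
proof -
  have "x \<in> (\<lambda>(i, j). (i + j) mod n) ` ({..<n} \<times> {..<n})" if "x < n" for x
    using that by (intro image_eqI[of _ _ "(0, x)"]) auto
  then have "(\<lambda>(i, j). (i + j) mod n) ` ({..<n} \<times> {..<n}) = {..<n}"
    using assms(3) by auto
  then have "has_interval_coloring (lex_product G (edgeless_graph n)) ((t - 1) * n + n)"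
    by (intro has_interval_coloring_lex_product_edgeless[where \<phi> = "\<lambda>k. k mod n"] assms)
      (auto intro!: exI[of _ 0] bij_betw_add_mod simp: atLeast0LessThan)
  moreover have "(t - 1) * n + n = t * n"
    using assms(2) by (cases t) (auto simp: has_interval_coloring_def)
  ultimately show ?thesis by simp
qed

lemma has_interval_coloring_lex_product_edgeless_Suc_mult:
  assumes "simple_graph G" "has_interval_coloring G t" "n \<ge> 1"
  shows "has_interval_coloring (lex_product G (edgeless_graph n)) ((t + 1) * n - 1)"
proof -
  have "x \<in> (\<lambda>(i, j). i + j) ` ({..<n} \<times> {..<n})" if "x < 2 * n - 1" for x
    \<comment> \<open>The first summand is made as large as possible; what remains is at most
      \<open>n - 1\<close> because \<open>x \<le> 2 * n - 2\<close>.\<close>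
    using that assms(3) by (intro image_eqI[of _ _ "(min x (n - 1), x - min x (n - 1))"]) auto
  then have range: "(\<lambda>(i, j). i + j) ` ({..<n} \<times> {..<n}) = {..<2 * n - 1}"
    by auto
  \<comment> \<open>Here the window starts at \<open>s = i\<close>; the windows for all
    \<open>i < n\<close> together cover \<open>2 * n - 1\<close> values, which is
    \<open>m\<close>.\<close>
  have "bij_betw (\<lambda>j. i + j) {..<n} {i..<i + n}" for i :: nat
    by (auto simp: bij_betw_def lessThan_atLeast0 add.commute)
  with range have "has_interval_coloring (lex_product G (edgeless_graph n)) ((t - 1) * n + (2 * n - 1))"
    using assms(3) by (intro has_interval_coloring_lex_product_edgeless[where \<phi> = "\<lambda>k. k"] assms) auto
  moreover have "(t - 1) * n + (2 * n - 1) = (t + 1) * n - 1"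
    using assms(2,3) by (cases t) (auto simp: has_interval_coloring_def)
  ultimately show ?thesis by simp
qed

theorem theorem16:
  fixes G :: "'a graph" and n :: nat
  assumes "G \<in> \<NN>" and "n \<ge> 1"
  shows "lex_product G (edgeless_graph n) \<in> \<NN> \<and>
         min_colors (lex_product G (edgeless_graph n)) \<le> min_colors G * n \<and>
         max_colors (lex_product G (edgeless_graph n)) \<ge> (max_colors G + 1) * n - 1"
proof -
  let ?P = "lex_product G (edgeless_graph n)"
  have G: "simple_graph G" and ne: "{t. has_interval_coloring G t} \<noteq> {}"
    using assms(1) by (auto simp: interval_colorable_graphs_def)
  have P: "simple_graph ?P" by (rule simple_graph_lex_product_edgeless[OF G])
  note fin = finite_has_interval_coloring[OF G] and finP = finite_has_interval_coloring[OF P]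
  \<comment> \<open>Both extremes are attained, the set being finite and nonempty, so optimal
    colourings of \<open>G\<close> can be expanded.\<close>
  have "has_interval_coloring G (min_colors G)" "has_interval_coloring G (max_colors G)"
    using Min_in[OF fin ne] Max_in[OF fin ne] by (simp_all add: min_colors_def max_colors_def)
  then have low: "has_interval_coloring ?P (min_colors G * n)"
    and high: "has_interval_coloring ?P ((max_colors G + 1) * n - 1)"
    using has_interval_coloring_lex_product_edgeless_mult[OF G _ assms(2)]
      has_interval_coloring_lex_product_edgeless_Suc_mult[OF G _ assms(2)] by blast+
  have "?P \<in> \<NN>" using P low by (auto simp: interval_colorable_graphs_def)
  moreover have "min_colors ?P \<le> min_colors G * n"
    unfolding min_colors_def[of ?P] using finP low by (intro Min_le) auto
  moreover have "max_colors ?P \<ge> (max_colors G + 1) * n - 1"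
    unfolding max_colors_def[of ?P] using finP high by (intro Max_ge) auto
  ultimately show ?thesis by blast
qed

end
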